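(* If $t\in\{1,2,3\}$, then $7\mid M(t,8n+4)$ for every integer $n\geq 0$.
   Context: For $t\geq 1$, the integers $M(t,n)$ are defined by the formal power series $$\sum_{n\geq0}M(t,n)\,q^n=\sum_{k\geq1}\frac{(-1)^{k-1}(1+q^k)\,q^{\binom{k}{2}+tk}}{(1-q^k)^{2t}},$$ which is equal to $\sum_{1\leq k_1\leq k_2\leq\cdots\leq k_t}\frac{q^{k_1+k_2+\cdots+k_t}}{(1-q^{k_1})^2(1-q^{k_2})^2\cdots(1-q^{k_t})^2}$. *)

theory Defs
  imports "HOL-Computational_Algebra.Formal_Power_Series"
begin

text \<open>
  Everything takes place in \<open>\<int>[[q]]\<close>, with \<open>q\<close> rendered as \<^const>\<open>fps_X\<close>. The library's
  division on formal power series requires a field of coefficients, so the denominator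
  \<open>(1 - q ^ k) ^ (2 * t)\<close>, whose constant term is \<open>1\<close>, is inverted with the library's
  \<^term>\<open>fps_right_inverse\<close>; the lemma \<open>M_den_inverse\<close> below confirms that this is the
  inverse in the ring.
\<close>

definition M_den :: "nat \<Rightarrow> nat \<Rightarrow> int fps" where
  "M_den t k = (1 - fps_X ^ k) ^ (2 * t)"

definition M_term :: "nat \<Rightarrow> nat \<Rightarrow> int fps" where
  "M_term t k =
     (-1) ^ (k - 1) * (1 + fps_X ^ k) * fps_X ^ ((k choose 2) + t * k) *
     fps_right_inverse (M_den t k) 1"

text \<open>
  The infinite sum is taken in the usual topology on formal power series. As \<^const>\<open>suminf\<close>
  starts at \<open>0\<close>, the index is shifted by one. The sum converges for \<open>t \<ge> 1\<close>
  (lemma \<open>M_gf_sums\<close>).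
\<close>

definition M_gf :: "nat \<Rightarrow> int fps" where
  "M_gf t = (\<Sum>k. M_term t (Suc k))"

definition M :: "nat \<Rightarrow> nat \<Rightarrow> int" where
  "M t n = fps_nth (M_gf t) n"

lemma M_den_inverse:
  assumes "k \<ge> 1"
  shows "M_den t k * fps_right_inverse (M_den t k) 1 = 1"
proof (rule fps_right_inverse)
  show "fps_nth (M_den t k) 0 * 1 = 1"
    using assms by (simp add: M_den_def fps_power_zeroth power_0_left)
qed

lemma M_term_nth_eq_0:
  assumes "t \<ge> 1" "n < k"
  shows "fps_nth (M_term t k) n = 0"
proof -
  have "n < (k choose 2) + t * k"
    using assms by (metis le_add2 less_le_trans mult_le_mono1 nat_mult_1)
  moreover have "M_term t k = fps_X ^ ((k choose 2) + t * k) *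
      ((-1) ^ (k - 1) * (1 + fps_X ^ k) * fps_right_inverse (M_den t k) 1)"
    by (simp add: M_term_def mult_ac)
  ultimately show ?thesis
    by (simp add: fps_X_power_mult_nth)
qed

lemma M_gf_sums:
  assumes "t \<ge> 1"
  shows "(\<lambda>k. M_term t (Suc k)) sums M_gf t"
proof -
  define S where "S = Abs_fps (\<lambda>n. \<Sum>k<n. fps_nth (M_term t (Suc k)) n)"
  have "(\<lambda>N. \<Sum>k<N. M_term t (Suc k)) \<longlonglongrightarrow> S"
  proof (rule tendsto_fpsI)
    fix n
    have "fps_nth (\<Sum>k<N. M_term t (Suc k)) n = fps_nth S n" if "N \<ge> n" for N
      unfolding S_def fps_sum_nth fps_nth_Abs_fps
      by (rule sum.mono_neutral_right) (use that assms in \<open>auto simp: M_term_nth_eq_0\<close>)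
    then show "\<forall>\<^sub>F N in sequentially. fps_nth (\<Sum>k<N. M_term t (Suc k)) n = fps_nth S n"
      by (auto simp: eventually_sequentially)
  qed
  then show ?thesis
    unfolding M_gf_def by (metis sums_def sums_unique)
qed

end

theory Submission
  imports Defs
begin

text \<open>
  The proof expresses \<open>M t n\<close> for \<open>t \<le> 3\<close> by the divisor power sums \<open>\<sigma>\<^sub>1\<close>, \<open>\<sigma>\<^sub>3\<close>, \<open>\<sigma>\<^sub>5\<close>:
  \<open>M 1 n = \<sigma>\<^sub>1 n\<close>,
  \<open>24 * M 2 n = 7 * \<sigma>\<^sub>3 n - (6 * n + 1) * \<sigma>\<^sub>1 n\<close>, and
  \<open>17280 * M 3 n = 279 * \<sigma>\<^sub>5 n - 630 * (n + 1) * \<sigma>\<^sub>3 n + (360 * n\<^sup>2 + 540 * n + 81) * \<sigma>\<^sub>1 n\<close>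
  (lemmas \<open>M_1\<close>, \<open>M_2\<close>, \<open>M_3\<close>). The coefficients of \<open>\<sigma>\<^sub>3\<close> are multiples of \<open>7\<close>. Moreover
  \<open>8 * n + 4\<close> is \<open>4\<close> times an odd number, so that \<open>\<sigma>\<^sub>1 (8 * n + 4)\<close> and \<open>\<sigma>\<^sub>5 (8 * n + 4)\<close> are multiples of
  \<open>\<sigma>\<^sub>1 4 = 7\<close> and \<open>\<sigma>\<^sub>5 4 = 1057 = 7 * 151\<close>. As the multipliers on the left are prime to \<open>7\<close>, the
  congruence follows.

  Two ingredients lead to these formulas. The first is that the alternating sum defining
  \<open>M t\<close> equals the complete homogeneous symmetric function \<open>h\<^sub>t\<close> of the series
  \<open>x\<^sub>k = q ^ k / (1 - q ^ k)\<^sup>2\<close>. For finitely many variables \<open>x\<^sub>1, \<dots>, x\<^sub>N\<close> this is Lagrange's formula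
  for \<open>h\<^sub>t\<close>, with weights that tend to \<open>1\<close> as \<open>N\<close> grows; it is proved by checking the
  recursion of \<open>h\<^sub>t\<close> in \<open>N\<close> and \<open>t\<close> (\<open>fin_M_0\<close>, \<open>fin_M_Suc\<close>, \<open>agree_M_gf\<close>). Newton's identities
  then give \<open>h\<^sub>1\<close>, \<open>h\<^sub>2\<close>, \<open>h\<^sub>3\<close> in terms of the power sums of the \<open>x\<^sub>k\<close>, which are linear
  combinations of the generating functions \<open>S\<^sub>j\<close> of \<open>\<sigma>\<^sub>j\<close> for \<open>j = 1, 3, 5\<close>
  (\<open>agree_power_sum_1\<close> and its companions).

  The second ingredient evaluates the products of the \<open>S\<^sub>j\<close> that arise. Ramanujan's formulas
  express \<open>S\<^sub>1\<^sup>2\<close> and \<open>S\<^sub>1 * S\<^sub>3\<close> linearly by \<open>S\<^sub>1\<close>, \<open>S\<^sub>3\<close>, \<open>S\<^sub>5\<close> and derivatives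
  (\<open>lambert_1_square\<close>, \<open>lambert_1_mult_3\<close>). Instead of using modular forms they are derived from
  a single elementary identity of Liouville type (\<open>liouville_convolution\<close>), which in turn comes from
  \<open>L a * L b = L (a + b) * (1 + L a + L b)\<close> for \<open>L m = q ^ m / (1 - q ^ m)\<close>.
\<close>

section \<open>Agreement of power series up to a given degree\<close>

text \<open>
  All series below converge because the degrees of their terms grow. For a fixed coefficient
  only finitely many terms matter, so every infinite sum is cut off at an index \<open>N\<close> and
  identities are stated modulo \<open>q ^ (N + 1)\<close>; a limit is taken only once, for
  \<^const>\<open>M_gf\<close>.
\<close>

definition agree :: "nat \<Rightarrow> int fps \<Rightarrow> int fps \<Rightarrow> bool" where
  "agree N f g \<longleftrightarrow> (\<forall>n\<le>N. fps_nth f n = fps_nth g n)"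

lemma agree_refl [simp]: "agree N f f"
  by (simp add: agree_def)

lemma agree_sym: "agree N f g \<Longrightarrow> agree N g f"
  by (simp add: agree_def)

lemma agree_trans [trans]: "agree N f g \<Longrightarrow> agree N g h \<Longrightarrow> agree N f h"
  by (simp add: agree_def)

lemma agree_add: "agree N f g \<Longrightarrow> agree N f' g' \<Longrightarrow> agree N (f + f') (g + g')"
  by (simp add: agree_def)

lemma agree_diff: "agree N f g \<Longrightarrow> agree N f' g' \<Longrightarrow> agree N (f - f') (g - g')"
  by (simp add: agree_def)

lemma agree_mult: "agree N f g \<Longrightarrow> agree N f' g' \<Longrightarrow> agree N (f * f') (g * g')"
  by (auto simp: agree_def fps_mult_nth intro!: sum.cong)

lemma agree_sum: "(\<And>i. i \<in> I \<Longrightarrow> agree N (f i) (g i)) \<Longrightarrow> agree N (sum f I) (sum g I)"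
  by (auto simp: agree_def fps_sum_nth intro!: sum.cong)

lemma agree_X_power_mult: "N < m \<Longrightarrow> agree N (fps_X ^ m * f) 0"
  by (simp add: agree_def fps_X_power_mult_nth)

lemma agree_mult_X_power: 
  assumes "agree N f g"
  shows "agree (N + m) (fps_X ^ m * f) (fps_X ^ m * g)"
  using assms by (auto simp: agree_def fps_X_power_mult_nth)

lemma agree_mono: "agree N f g \<Longrightarrow> K \<le> N \<Longrightarrow> agree K f g"
  by (auto simp: agree_def)

section \<open>Products of the series q^m / (1 - q^m)\<close>

text \<open>
  This is \<open>q ^ m / (1 - q ^ m)\<close>, and \<open>1 + geo m\<close> is the inverse of \<open>1 - q ^ m\<close>. Having both
  as integer series avoids division throughout.
\<close>

definition geo :: "nat \<Rightarrow> int fps" where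
  "geo m = Abs_fps (\<lambda>n. of_bool (0 < n \<and> m dvd n))"

lemma geo_nth [simp]: "fps_nth (geo m) n = of_bool (0 < n \<and> m dvd n)"
  by (simp add: geo_def)

lemma geo_mult_denom:
  assumes "m > 0"
  shows "geo m * (1 - fps_X ^ m) = fps_X ^ m"
proof (rule fps_ext)
  fix n
  have "m \<le> n" if "m dvd n" "n > 0"
    using that by (simp add: dvd_imp_le)
  then show "fps_nth (geo m * (1 - fps_X ^ m)) n = fps_nth (fps_X ^ m) n"
    using assms by (auto simp: right_diff_distrib fps_X_power_mult_right_nth dvd_minus_self)
qed

lemma geo_eq: "m > 0 \<Longrightarrow> geo m = fps_X ^ m * (1 + geo m)"
  using geo_mult_denom[of m] by (simp add: algebra_simps)

lemma denom_nonzero: "m > 0 \<Longrightarrow> 1 - fps_X ^ m \<noteq> (0 :: int fps)"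
proof
  assume "m > 0" "1 - fps_X ^ m = (0 :: int fps)"
  then have "fps_nth (1 - fps_X ^ m :: int fps) 0 = 0" by simp
  with \<open>m > 0\<close> show False by simp
qed

lemma denom_inverse: "m > 0 \<Longrightarrow> (1 - fps_X ^ m) * (1 + geo m) = 1"
  using geo_mult_denom[of m] by (simp add: algebra_simps)

text \<open>
  Partial fractions in two variables: after clearing denominators, this and the next lemma
  reduce to \<open>1 - x * y = (1 - x) * (1 - y) + x * (1 - y) + y * (1 - x)\<close> and
  to \<open>y - x * y = y * (1 - x)\<close>, where \<open>x\<close> and \<open>y\<close> are powers of \<open>q\<close>.
\<close>

lemma geo_mult_geo:
  assumes "a > 0" "b > 0"
  shows "geo a * geo b = geo (a + b) * (1 + geo a + geo b)"
proof -
  \<comment> \<open>The powers have symbolic exponents; naming them leaves a polynomial identity.\<close>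
  define x y :: "int fps" where "x = fps_X ^ a" and "y = fps_X ^ b"
  have *: "geo (a + b) * (1 - fps_X ^ a * fps_X ^ b) = fps_X ^ a * fps_X ^ b"
    using geo_mult_denom[of "a + b"] assms by (simp add: power_add)
  have "(geo a * geo b) * (1 - fps_X ^ (a + b)) = 
        geo (a + b) * (1 + geo a + geo b) * (1 - fps_X ^ (a + b))"
    using geo_eq[OF assms(1)] geo_eq[OF assms(2)] *
    unfolding power_add x_def[symmetric] y_def[symmetric] by algebra
  then show ?thesis using denom_nonzero[of "a + b"] assms by simp
qed

lemma geo_mult_geo_shift:
  assumes "b > 0" "m > 0"
  shows "geo b * geo (b + m) = geo m * (geo b - geo (b + m)) - geo (b + m)"
proof -
  define x y :: "int fps" where "x = fps_X ^ b" and "y = fps_X ^ m"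
  have *: "geo (b + m) * (1 - fps_X ^ b * fps_X ^ m) = fps_X ^ b * fps_X ^ m"
    using geo_mult_denom[of "b + m"] assms by (simp add: power_add)
  have "(geo b * geo (b + m)) * (1 - fps_X ^ (b + m)) = 
        (geo m * (geo b - geo (b + m)) - geo (b + m)) * (1 - fps_X ^ (b + m))"
    using geo_eq[OF assms(1)] geo_eq[OF assms(2)] *
    unfolding power_add x_def[symmetric] y_def[symmetric] by algebra
  then show ?thesis using denom_nonzero[of "b + m"] assms by simp
qed

lemma agree_geo_0: "N < m \<Longrightarrow> agree N (geo m) 0"
  by (auto simp: agree_def dvd_imp_le dest: dvd_imp_le)

lemma agree_geo_mult_geo_0:
  assumes "a > 0" "b > 0" "N < a + b"
  shows "agree N (geo a * geo b) 0"
proof -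
  define x y :: "int fps" where "x = fps_X ^ a" and "y = fps_X ^ b"
  have "geo a * geo b = fps_X ^ (a + b) * ((1 + geo a) * (1 + geo b))"
    using geo_eq[OF assms(1)] geo_eq[OF assms(2)]
    unfolding power_add x_def[symmetric] y_def[symmetric] by algebra
  then show ?thesis using agree_X_power_mult assms(3) by metis
qed

section \<open>A convolution identity of Liouville type\<close>

lemma sum_geo_fixed_sum:
  assumes "m > 0"
  shows "(\<Sum>a\<in>{1..<m}. geo a * geo (m - a)) = geo m * (of_nat (m - 1) + 2 * (\<Sum>a\<in>{1..<m}. geo a))"
proof -
  have "(\<Sum>a\<in>{1..<m}. geo a * geo (m - a)) = (\<Sum>a\<in>{1..<m}. geo m * (1 + geo a + geo (m - a)))"
    by (intro sum.cong refl) (use geo_mult_geo in force)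
  also have "\<dots> = geo m * (of_nat (m - 1) + (\<Sum>a\<in>{1..<m}. geo a) + (\<Sum>a\<in>{1..<m}. geo (m - a)))"
    by (simp add: sum_distrib_left[symmetric] sum.distrib)
  also have "(\<Sum>a\<in>{1..<m}. geo (m - a)) = (\<Sum>a\<in>{1..<m}. geo a)"
    by (rule sum.reindex_bij_witness[of _ "\<lambda>a. m - a" "\<lambda>a. m - a"]) auto
  finally show ?thesis by (simp add: algebra_simps)
qed

text \<open>
  By \<open>geo_mult_geo_shift\<close> the sum telescopes: all of \<open>geo b - geo (b + m)\<close> cancels except the
  first \<open>m\<close> terms, the tail beyond \<open>N\<close> being invisible.
\<close>

lemma sum_geo_fixed_difference:
  assumes "m \<in> {1..N}"
  shows "agree N (\<Sum>b\<in>{1..N}. geo b * geo (b + m))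
           (geo m * (\<Sum>b\<in>{1..m}. geo b) - (\<Sum>b\<in>{m<..N}. geo b))"
proof -
  have shift: "agree N (\<Sum>b\<in>{1..N}. geo (b + m)) (\<Sum>b\<in>{m<..N}. geo b)"
  proof -
    have "(\<Sum>b\<in>{1..N}. geo (b + m)) = (\<Sum>b\<in>{m<..N+m}. geo b)"
      by (rule sum.reindex_bij_witness[of _ "\<lambda>b. b - m" "\<lambda>b. b + m"]) auto
    also have "{m<..N+m} = {m<..N} \<union> {N<..N+m}" using assms by auto
    also have "(\<Sum>b\<in>\<dots>. geo b) = (\<Sum>b\<in>{m<..N}. geo b) + (\<Sum>b\<in>{N<..N+m}. geo b)"
      by (rule sum.union_disjoint) auto
    also have "agree N \<dots> ((\<Sum>b\<in>{m<..N}. geo b) + (\<Sum>b\<in>{N<..N+m}. 0))"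
      by (intro agree_add agree_refl agree_sum agree_geo_0) auto
    finally show ?thesis by simp
  qed
  have split: "(\<Sum>b\<in>{1..N}. geo b) = (\<Sum>b\<in>{1..m}. geo b) + (\<Sum>b\<in>{m<..N}. geo b)"
  proof -
    have "{1..N} = {1..m} \<union> {m<..N}" using assms by auto
    then show ?thesis by (simp add: sum.union_disjoint ivl_disj_int)
  qed
  have "(\<Sum>b\<in>{1..N}. geo b * geo (b + m)) = 
        (\<Sum>b\<in>{1..N}. geo m * (geo b - geo (b + m)) - geo (b + m))"
    using assms by (intro sum.cong refl geo_mult_geo_shift) auto
  also have "\<dots> = geo m * ((\<Sum>b\<in>{1..N}. geo b) - (\<Sum>b\<in>{1..N}. geo (b + m))) - (\<Sum>b\<in>{1..N}. geo (b + m))"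
    by (simp only: sum_subtractf sum_distrib_left[symmetric])
  also have "agree N \<dots> (geo m * ((\<Sum>b\<in>{1..N}. geo b) - (\<Sum>b\<in>{m<..N}. geo b)) - (\<Sum>b\<in>{m<..N}. geo b))"
    by (intro agree_diff agree_mult agree_refl shift)
  finally show ?thesis by (simp only: split add_diff_cancel_right')
qed

lemma sum_pairs_by_sum:
  fixes F :: "int \<Rightarrow> int"
  shows "agree N (\<Sum>a\<in>{1..N}. \<Sum>b\<in>{1..N}. of_int (F (int a + int b)) * (geo a * geo b))
    (\<Sum>m\<in>{1..N}. of_int (F (int m)) * (\<Sum>a\<in>{1..<m}. geo a * geo (m - a)))"
proof -
  let ?h = "\<lambda>(a, b). of_int (F (int a + int b)) * (geo a * geo b)"
  have "(\<Sum>a\<in>{1..N}. \<Sum>b\<in>{1..N}. of_int (F (int a + int b)) * (geo a * geo b)) = sum ?h ({1..N} \<times> {1..N})"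
    by (simp add: sum.cartesian_product)
  also have "agree N \<dots> (\<Sum>p\<in>{1..N} \<times> {1..N}. if fst p + snd p \<le> N then ?h p else 0)"
  proof (rule agree_sum)
    fix p assume "p \<in> {1..N} \<times> {1..N}"
    then show "agree N (?h p) (if fst p + snd p \<le> N then ?h p else 0)"
      using agree_mult[OF agree_refl agree_geo_mult_geo_0[of "fst p" "snd p" N], of "of_int (F (int (fst p) + int (snd p)))"]
      by (auto simp: case_prod_beta)
  qed
  also have "(\<Sum>p\<in>{1..N} \<times> {1..N}. if fst p + snd p \<le> N then ?h p else 0) 
     = sum ?h {p \<in> {1..N} \<times> {1..N}. fst p + snd p \<le> N}"
    by (rule sum.inter_filter[symmetric]) simp
  also have "\<dots> = (\<Sum>(m, a)\<in>(SIGMA m:{1..N}. {1..<m}). of_int (F (int m)) * (geo a * geo (m - a)))"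
    by (rule sum.reindex_bij_witness[of _ "\<lambda>(m, a). (a, m - a)" "\<lambda>(a, b). (a + b, a)"]) auto
  also have "\<dots> = (\<Sum>m\<in>{1..N}. of_int (F (int m)) * (\<Sum>a\<in>{1..<m}. geo a * geo (m - a)))"
    by (simp add: sum.Sigma[symmetric] sum_distrib_left)
  finally show ?thesis .
qed

text \<open>
  The pairs with \<open>a > b\<close> and those with \<open>a < b\<close> contribute equally as \<open>F\<close> is even, whence the
  factor \<open>2\<close>; the diagonal disappears because \<open>F 0 = 0\<close>. Letting \<open>b\<close> run up to \<open>N\<close> for every
  difference \<open>m\<close> only adds terms of degree above \<open>N\<close>.
\<close>

lemma sum_pairs_by_difference:
  fixes F :: "int \<Rightarrow> int"
  assumes even: "\<And>x. F (- x) = F x" and zero: "F 0 = 0"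
  shows "agree N (\<Sum>a\<in>{1..N}. \<Sum>b\<in>{1..N}. of_int (F (int a - int b)) * (geo a * geo b))
    (\<Sum>m\<in>{1..N}. of_int (F (int m)) * (2 * (\<Sum>b\<in>{1..N}. geo b * geo (b + m))))"
proof -
  let ?h = "\<lambda>(a, b). of_int (F (int a - int b)) * (geo a * geo b)"
  let ?P = "{1..N} \<times> {1..N}"
  let ?U = "{p \<in> ?P. snd p < fst p}"
  let ?D = "{p \<in> ?P. fst p < snd p}"
  let ?k = "\<lambda>(m, b). of_int (F (int m)) * (geo b * geo (b + m))"
  have "(\<Sum>a\<in>{1..N}. \<Sum>b\<in>{1..N}. of_int (F (int a - int b)) * (geo a * geo b)) = sum ?h ?P"
    by (simp add: sum.cartesian_product)
  also have "\<dots> = sum ?h (?U \<union> ?D)"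
  proof (rule sum.mono_neutral_right)
    show "\<forall>p\<in>?P - (?U \<union> ?D). ?h p = 0"
    proof
      fix p assume "p \<in> ?P - (?U \<union> ?D)"
      then have "fst p = snd p" using linorder_neqE_nat by blast
      then show "?h p = 0" by (simp add: case_prod_beta zero)
    qed
  qed auto
  also have "\<dots> = sum ?h ?U + sum ?h ?D"
    by (rule sum.union_disjoint) auto
  also have "sum ?h ?D = sum ?h ?U"
  proof (rule sum.reindex_bij_witness[of _ prod.swap prod.swap])
    fix p assume "p \<in> ?D"
    show "?h (prod.swap p) = ?h p"
      using even[of "int (fst p) - int (snd p)"] by (cases p) (simp add: mult_ac)
  qed auto
  also have "sum ?h ?U = sum ?k {p \<in> ?P. fst p + snd p \<le> N}"
    by (rule sum.reindex_bij_witness[of _ "\<lambda>(m, b). (b + m, b)" "\<lambda>(a, b). (a - b, b)"])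
      (auto simp: mult_ac of_nat_diff)
  also have "\<dots> = (\<Sum>p\<in>?P. if fst p + snd p \<le> N then ?k p else 0)"
    by (rule sum.inter_filter) simp
  finally have "(\<Sum>a\<in>{1..N}. \<Sum>b\<in>{1..N}. of_int (F (int a - int b)) * (geo a * geo b)) =
    2 * (\<Sum>p\<in>?P. if fst p + snd p \<le> N then ?k p else 0)" by simp
  also have "agree N \<dots> (2 * sum ?k ?P)"
  proof (intro agree_mult agree_refl agree_sum)
    fix p assume "p \<in> ?P"
    then show "agree N (if fst p + snd p \<le> N then ?k p else 0) (?k p)"
      using agree_sym[OF agree_mult[OF agree_refl agree_mult[OF agree_refl agree_geo_0[of N "snd p + fst p"]],
        of "of_int (F (int (fst p)))" "geo (snd p)"]]
      by (auto simp: case_prod_beta add.commute)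
  qed
  also have "2 * sum ?k ?P = (\<Sum>m\<in>{1..N}. of_int (F (int m)) * (2 * (\<Sum>b\<in>{1..N}. geo b * geo (b + m))))"
    by (simp add: sum.cartesian_product[symmetric] sum_distrib_left mult_ac)
  finally show ?thesis .
qed

text \<open>
  Group the pairs \<open>(a, b)\<close> by \<open>m = a - b\<close> and by \<open>m = a + b\<close>. With \<open>L m\<close> for \<open>geo m\<close>, the
  coefficient of \<open>F m\<close> is
  \<open>2 * L m * (L 1 + \<dots> + L m) - 2 * (L (m + 1) + \<dots>)\<close> in the first grouping and
  \<open>L m * (m - 1 + 2 * (L 1 + \<dots> + L (m - 1)))\<close> in the second. The products of different \<open>L\<close>
  cancel in the difference, so a double sum becomes a single one. Exchanging the order of
  summation in the remaining tail turns it into the sums of \<open>F j\<close> over \<open>j < m\<close>.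
  Choosing \<open>F\<close> as an even power yields convolution formulas for divisor power sums.
\<close>

lemma liouville_convolution:
  fixes F :: "int \<Rightarrow> int"
  assumes even: "\<And>x. F (- x) = F x" and zero: "F 0 = 0"
  shows "agree N 
    (\<Sum>a\<in>{1..N}. \<Sum>b\<in>{1..N}. of_int (F (int a - int b) - F (int a + int b)) * (geo a * geo b))
    (\<Sum>m\<in>{1..N}. of_int (F (int m)) * (2 * geo m ^ 2 - of_nat (m - 1) * geo m) 
       - 2 * of_int (\<Sum>j<m. F (int j)) * geo m)"
proof -
  have swap: "(\<Sum>m\<in>{1..N}. of_int (F (int m)) * (\<Sum>b\<in>{m<..N}. geo b)) =
     (\<Sum>m\<in>{1..N}. of_int (\<Sum>j<m. F (int j)) * geo m)"
  proof -
    have "(\<Sum>m\<in>{1..N}. of_int (F (int m)) * (\<Sum>b\<in>{m<..N}. geo b)) = 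
      (\<Sum>m\<in>{1..N}. \<Sum>b\<in>{b \<in> {1..N}. m < b}. of_int (F (int m)) * geo b)"
      by (intro sum.cong refl) (auto simp: sum_distrib_left intro!: sum.cong)
    also have "\<dots> = (\<Sum>b\<in>{1..N}. \<Sum>m\<in>{m \<in> {1..N}. m < b}. of_int (F (int m)) * geo b)"
      by (rule sum.swap_restrict) auto
    also have "\<dots> = (\<Sum>b\<in>{1..N}. of_int (\<Sum>j<b. F (int j)) * geo b)"
    proof (intro sum.cong refl)
      fix b assume b: "b \<in> {1..N}"
      have "(\<Sum>m\<in>{m \<in> {1..N}. m < b}. F (int m)) = (\<Sum>m<b. F (int m))"
        using b zero by (intro sum.mono_neutral_left) (auto simp: Suc_le_eq intro!: gr0I)
      then show "(\<Sum>m\<in>{m \<in> {1..N}. m < b}. of_int (F (int m)) * geo b) = of_int (\<Sum>j<b. F (int j)) * geo b"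
        by (simp add: sum_distrib_right[symmetric] of_int_sum[symmetric] del: of_int_sum)
    qed
    finally show ?thesis .
  qed
  let ?pairs = "\<lambda>g. \<Sum>a\<in>{1..N}. \<Sum>b\<in>{1..N}. of_int (g (int a) (int b)) * (geo a * geo b)"
  let ?by_sum = "\<Sum>m\<in>{1..N}. of_int (F (int m)) * (\<Sum>a\<in>{1..<m}. geo a * geo (m - a))"
  let ?by_diff = "\<Sum>m\<in>{1..N}. of_int (F (int m)) * (2 * (\<Sum>b\<in>{1..N}. geo b * geo (b + m)))"
  let ?by_diff' = "\<Sum>m\<in>{1..N}. of_int (F (int m)) *
    (2 * (geo m * (\<Sum>b\<in>{1..m}. geo b) - (\<Sum>b\<in>{m<..N}. geo b)))"
  let ?main = "\<lambda>m. of_int (F (int m)) * (2 * geo m ^ 2 - of_nat (m - 1) * geo m)"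
  have split: "?pairs (\<lambda>a b. F (a - b) - F (a + b)) = ?pairs (\<lambda>a b. F (a - b)) - ?pairs (\<lambda>a b. F (a + b))"
    by (simp add: sum_subtractf left_diff_distrib)
  have reduce1: "agree N (?pairs (\<lambda>a b. F (a - b)) - ?pairs (\<lambda>a b. F (a + b))) (?by_diff - ?by_sum)"
    by (rule agree_diff[OF sum_pairs_by_difference sum_pairs_by_sum]) (rule even zero)+
  have "agree N ?by_diff ?by_diff'"
    by (rule agree_sum, rule agree_mult[OF agree_refl], rule agree_mult[OF agree_refl],
        rule sum_geo_fixed_difference)
  then have reduce2: "agree N (?by_diff - ?by_sum) (?by_diff' - ?by_sum)"
    by (rule agree_diff[OF _ agree_refl])
  have "?by_diff' - ?by_sum = (\<Sum>m\<in>{1..N}. ?main m - 2 * (of_int (F (int m)) * (\<Sum>b\<in>{m<..N}. geo b)))"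
  proof (subst sum_subtractf[symmetric], rule sum.cong[OF refl])
    fix m assume m: "m \<in> {1..N}"
    then have m0: "m > 0" by simp
    have "{1..m} = insert m {1..<m}" using m by auto
    then have s: "(\<Sum>b\<in>{1..m}. geo b) = geo m + (\<Sum>b\<in>{1..<m}. geo b)" by simp
    show "of_int (F (int m)) * (2 * (geo m * (\<Sum>b\<in>{1..m}. geo b) - (\<Sum>b\<in>{m<..N}. geo b))) -
         of_int (F (int m)) * (\<Sum>a\<in>{1..<m}. geo a * geo (m - a)) =
         ?main m - 2 * (of_int (F (int m)) * (\<Sum>b\<in>{m<..N}. geo b))"
      unfolding sum_geo_fixed_sum[OF m0] s by (simp add: algebra_simps power2_eq_square)
  qed
  also have "\<dots> = sum ?main {1..N} - 2 * (\<Sum>m\<in>{1..N}. of_int (F (int m)) * (\<Sum>b\<in>{m<..N}. geo b))"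
    by (simp only: sum_subtractf sum_distrib_left)
  also have "\<dots> = (\<Sum>m\<in>{1..N}. ?main m - 2 * of_int (\<Sum>j<m. F (int j)) * geo m)"
    unfolding swap by (simp only: sum_subtractf sum_distrib_left mult.assoc)
  finally have collect: "?by_diff' - ?by_sum = \<dots>" .
  show ?thesis
    using agree_trans[OF reduce1 reduce2] unfolding split collect .
qed

section \<open>Convolutions of divisor power sums\<close>

text \<open>
  Up to degree \<open>N\<close> this Lambert series is the generating function of the divisor power
  sums with exponent \<open>j\<close>. For odd \<open>j\<close> that is, up to scaling, an Eisenstein series
  without its constant term.
\<close>

definition lambert :: "nat \<Rightarrow> nat \<Rightarrow> int fps" where
  "lambert j N = (\<Sum>m\<in>{1..N}. of_nat m ^ j * geo m)"

definition qderiv :: "int fps \<Rightarrow> int fps" where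
  "qderiv f = fps_X * fps_deriv f"

lemma qderiv_nth: "fps_nth (qderiv f) n = of_nat n * fps_nth f n"
  by (cases n) (simp_all add: qderiv_def)

lemma qderiv_mult: "qderiv (f * g) = qderiv f * g + f * qderiv g"
  by (simp add: qderiv_def algebra_simps)

lemma of_nat_power_mult_nth: "fps_nth (of_nat m ^ j * f) n = int m ^ j * fps_nth f n"
  by (simp flip: fps_of_nat)

lemma sum_sum_mult:
  fixes c :: "'a :: comm_semiring_0"
  shows "(\<Sum>a\<in>A. \<Sum>b\<in>B. c * (f a * g b)) = c * (sum f A * sum g B)"
  unfolding sum_product unfolding sum_distrib_left ..

lemma qderiv_lambert: "qderiv (lambert j N) = (\<Sum>m\<in>{1..N}. of_nat m ^ j * qderiv (geo m))"
  by (intro fps_ext) (simp only: qderiv_nth lambert_def fps_sum_nth sum_distrib_left of_nat_power_mult_nth mult.left_commute)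

text \<open>
  This eliminates the squares that are left over in \<open>liouville_convolution\<close> and is
  the source of the derivatives in Ramanujan's formulas.
\<close>

lemma qderiv_geo:
  assumes "m > 0"
  shows "qderiv (geo m) = of_nat m * (geo m + geo m ^ 2)"
proof -
  define x :: "int fps" where "x = fps_X ^ m"
  have DX: "qderiv x = of_nat m * x"
    unfolding x_def by (intro fps_ext) (simp add: qderiv_nth flip: fps_of_nat)
  have "qderiv (geo m * (1 - fps_X ^ m)) = qderiv (fps_X ^ m)"
    using geo_mult_denom[OF assms] by simp
  moreover have "qderiv (geo m * (1 - fps_X ^ m)) = qderiv (geo m) * (1 - fps_X ^ m) - geo m * qderiv (fps_X ^ m)"
    by (simp add: qderiv_mult) (simp add: qderiv_def algebra_simps)
  ultimately have "qderiv (geo m) * (1 - fps_X ^ m) = (of_nat m * (geo m + geo m ^ 2)) * (1 - fps_X ^ m)"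
    using geo_eq[OF assms] unfolding x_def[symmetric] DX by algebra
  then show ?thesis using denom_nonzero[OF assms] by simp
qed

lemma lambert_nth:
  assumes "0 < n" "n \<le> N"
  shows "fps_nth (lambert j N) n = (\<Sum>d | d dvd n. int d ^ j)"
proof -
  have "fps_nth (lambert j N) n = (\<Sum>m\<in>{1..N}. if m dvd n then int m ^ j else 0)"
    using assms unfolding lambert_def fps_sum_nth
    by (intro sum.cong) (auto simp: of_nat_power_mult_nth)
  also have "\<dots> = (\<Sum>m\<in>{m\<in>{1..N}. m dvd n}. int m ^ j)"
    by (rule sum.inter_filter[symmetric]) simp
  also have "{m\<in>{1..N}. m dvd n} = {d. d dvd n}"
    using assms by (auto dest: dvd_imp_le intro: Nat.gr0I simp: Suc_le_eq)
  finally show ?thesis .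
qed

lemma sum_below_square: "6 * (\<Sum>j<m. int j ^ 2) = 2 * int m ^ 3 - 3 * int m ^ 2 + int m"
  by (induction m) (auto simp: algebra_simps power2_eq_square power3_eq_cube)

lemma sum_below_power4: 
  "30 * (\<Sum>j<m. int j ^ 4) = 6 * int m ^ 5 - 15 * int m ^ 4 + 10 * int m ^ 3 - int m"
  by (induction m) (auto simp: algebra_simps power_numeral_reduce)

text \<open>
  Ramanujan's formulas for \<open>P\<^sup>2\<close> and \<open>P * Q\<close>, where \<open>P\<close> and \<open>Q\<close> are the
  Eisenstein series of weights 2 and 4, free of denominators. They come from
  \<open>(a - b)\<^sup>2 - (a + b)\<^sup>2 = - 4 * a * b\<close> and
  \<open>(a - b) ^ 4 - (a + b) ^ 4 = - 8 * (a * b ^ 3 + a ^ 3 * b)\<close>. The power sums over \<open>j < m\<close>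
  have denominators \<open>6\<close> and \<open>30\<close> and occur twice, hence the multipliers \<open>3\<close> and \<open>15\<close> in the proofs.
\<close>

lemma lambert_1_square:
  "agree N (12 * lambert 1 N ^ 2) (5 * lambert 3 N + lambert 1 N - 6 * qderiv (lambert 1 N))"
proof -
  let ?F = "\<lambda>x :: int. x ^ 2"
  let ?L = "\<Sum>a\<in>{1..N}. \<Sum>b\<in>{1..N}. of_int (?F (int a - int b) - ?F (int a + int b)) * (geo a * geo b)"
  let ?R = "\<Sum>m\<in>{1..N}. of_int (?F (int m)) * (2 * geo m ^ 2 - of_nat (m - 1) * geo m)
       - 2 * of_int (\<Sum>j<m. ?F (int j)) * geo m"
  have "?L
     = (\<Sum>a\<in>{1..N}. \<Sum>b\<in>{1..N}. - 4 * ((of_nat a * geo a) * (of_nat b * geo b)))"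
    by (intro sum.cong refl) (simp add: algebra_simps power2_eq_square)
  also have "\<dots> = - 4 * lambert 1 N ^ 2"
    unfolding sum_sum_mult by (simp add: lambert_def power2_eq_square)
  finally have l: "?L
      = - 4 * lambert 1 N ^ 2" .
  have "3 * ?R = 
    (\<Sum>m\<in>{1..N}. 6 * (of_nat m ^ 1 * qderiv (geo m)) - 5 * (of_nat m ^ 3 * geo m) - of_nat m ^ 1 * geo m)"
    unfolding sum_distrib_left
  proof (intro sum.cong refl)
    fix m assume "m \<in> {1..N}"
    then have m: "m > 0" by simp
    have s: "of_int (6 * (\<Sum>j<m. int j ^ 2)) = (2 * of_nat m ^ 3 - 3 * of_nat m ^ 2 + of_nat m :: int fps)"
      by (subst sum_below_square) simp
    have g: "of_nat (m - 1) = (of_nat m - 1 :: int fps)"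
      using m by (simp add: of_nat_diff)
    show "3 * (of_int (?F (int m)) * (2 * geo m ^ 2 - of_nat (m - 1) * geo m) 
       - 2 * of_int (\<Sum>j<m. ?F (int j)) * geo m) =
       6 * (of_nat m ^ 1 * qderiv (geo m)) - 5 * (of_nat m ^ 3 * geo m) - of_nat m ^ 1 * geo m"
      unfolding qderiv_geo[OF m] g using s by (simp only: of_int_mult of_int_power of_int_of_nat_eq of_int_numeral) algebra
  qed
  also have "\<dots> = 6 * qderiv (lambert 1 N) - 5 * lambert 3 N - lambert 1 N"
    by (simp only: sum_subtractf sum_distrib_left[symmetric] qderiv_lambert) (simp add: lambert_def)
  finally have r: "3 * ?R = 6 * qderiv (lambert 1 N) - 5 * lambert 3 N - lambert 1 N" .
  have "agree N (- 3 * ?L) (- 3 * ?R)"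
    by (rule agree_mult[OF agree_refl], rule liouville_convolution) simp_all
  then show ?thesis
    unfolding mult_minus_left r l by (simp add: algebra_simps)
qed

lemma lambert_1_mult_3:
  "agree N (240 * (lambert 1 N * lambert 3 N)) 
     (21 * lambert 5 N + 10 * lambert 3 N - lambert 1 N - 30 * qderiv (lambert 3 N))"
proof -
  let ?F = "\<lambda>x :: int. x ^ 4"
  let ?L = "\<Sum>a\<in>{1..N}. \<Sum>b\<in>{1..N}. of_int (?F (int a - int b) - ?F (int a + int b)) * (geo a * geo b)"
  let ?R = "\<Sum>m\<in>{1..N}. of_int (?F (int m)) * (2 * geo m ^ 2 - of_nat (m - 1) * geo m)
       - 2 * of_int (\<Sum>j<m. ?F (int j)) * geo m"
  have "?L
     = (\<Sum>a\<in>{1..N}. \<Sum>b\<in>{1..N}. - 8 * ((of_nat a ^ 1 * geo a) * (of_nat b ^ 3 * geo b)) - 8 * ((of_nat a ^ 3 * geo a) * (of_nat b ^ 1 * geo b)))"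
    by (intro sum.cong refl) (simp add: algebra_simps power_numeral_reduce)
  also have "\<dots> = - 16 * (lambert 1 N * lambert 3 N)"
    unfolding sum_subtractf sum_sum_mult lambert_def[symmetric] by simp
  finally have l: "?L
      = - 16 * (lambert 1 N * lambert 3 N)" .
  have "15 * ?R = 
    (\<Sum>m\<in>{1..N}. 30 * (of_nat m ^ 3 * qderiv (geo m)) - 21 * (of_nat m ^ 5 * geo m) - 10 * (of_nat m ^ 3 * geo m) + of_nat m ^ 1 * geo m)"
    unfolding sum_distrib_left
  proof (intro sum.cong refl)
    fix m assume "m \<in> {1..N}"
    then have m: "m > 0" by simp
    have s: "of_int (30 * (\<Sum>j<m. int j ^ 4)) = (6 * of_nat m ^ 5 - 15 * of_nat m ^ 4 + 10 * of_nat m ^ 3 - of_nat m :: int fps)"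
      by (subst sum_below_power4) simp
    have g: "of_nat (m - 1) = (of_nat m - 1 :: int fps)"
      using m by (simp add: of_nat_diff)
    show "15 * (of_int (?F (int m)) * (2 * geo m ^ 2 - of_nat (m - 1) * geo m) 
       - 2 * of_int (\<Sum>j<m. ?F (int j)) * geo m) =
       30 * (of_nat m ^ 3 * qderiv (geo m)) - 21 * (of_nat m ^ 5 * geo m) - 10 * (of_nat m ^ 3 * geo m) + of_nat m ^ 1 * geo m"
      unfolding qderiv_geo[OF m] g using s by (simp only: of_int_mult of_int_power of_int_of_nat_eq of_int_numeral) algebra
  qed
  also have "\<dots> = 30 * qderiv (lambert 3 N) - 21 * lambert 5 N - 10 * lambert 3 N + lambert 1 N"
    by (simp only: sum.distrib sum_subtractf sum_distrib_left[symmetric] qderiv_lambert) (simp add: lambert_def)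
  finally have r: "15 * ?R = 30 * qderiv (lambert 3 N) - 21 * lambert 5 N - 10 * lambert 3 N + lambert 1 N" .
  have "agree N (- 15 * ?L) (- 15 * ?R)"
    by (rule agree_mult[OF agree_refl], rule liouville_convolution) simp_all
  then show ?thesis
    unfolding mult_minus_left r l by (simp add: algebra_simps)
qed

section \<open>The alternating sum as a complete homogeneous symmetric function\<close>

text \<open>
  These are MacMahon's series \<open>q ^ k / (1 - q ^ k)\<^sup>2\<close>, which serve as the variables of the
  symmetric functions below.
\<close>

definition mac :: "nat \<Rightarrow> int fps" where
  "mac k = fps_X ^ k * (1 + geo k) ^ 2"

definition qfac :: "nat \<Rightarrow> int fps" where
  "qfac n = (\<Prod>j\<in>{1..n}. 1 - fps_X ^ j)"

definition inv_qfac :: "nat \<Rightarrow> int fps" where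
  "inv_qfac n = (\<Prod>j\<in>{1..n}. 1 + geo j)"

lemma qfac_0 [simp]: "qfac 0 = 1" and inv_qfac_0 [simp]: "inv_qfac 0 = 1"
  by (simp_all add: qfac_def inv_qfac_def)

lemma qfac_Suc: "qfac (Suc n) = qfac n * (1 - fps_X ^ Suc n)"
  and inv_qfac_Suc: "inv_qfac (Suc n) = inv_qfac n * (1 + geo (Suc n))"
  by (simp_all add: qfac_def inv_qfac_def)

lemma qfac_mult_inv_qfac: "qfac n * inv_qfac n = 1"
  unfolding qfac_def inv_qfac_def prod.distrib[symmetric]
  by (rule prod.neutral) (simp add: denom_inverse)

lemma inv_qfac_pred: "n > 0 \<Longrightarrow> inv_qfac (n - 1) = inv_qfac n * (1 - fps_X ^ n)"
  using denom_inverse[of n] by (cases n) (simp_all add: inv_qfac_Suc mult_ac)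

lemma qfac_pred: "n > 0 \<Longrightarrow> qfac n = qfac (n - 1) * (1 - fps_X ^ n)"
  by (cases n) (simp_all add: qfac_Suc)

text \<open>
  The factor \<open>(q)\<^sub>N\<^sup>2 / ((q)\<^sub>N\<^sub>-\<^sub>k * (q)\<^sub>N\<^sub>+\<^sub>k)\<close> by which the \<open>k\<close>-th term has to be
  multiplied when only the variables \<open>mac 1, \<dots>, mac N\<close> are present. It is what Lagrange
  interpolation produces: up to the factors kept in \<open>M_term\<close>, it equals the product of
  \<open>mac k / (mac k - mac j)\<close> over \<open>j \<noteq> k\<close>. The value \<open>0\<close> for \<open>k > N\<close> stands for a variable
  that has not been introduced yet.
\<close>

definition weight :: "nat \<Rightarrow> nat \<Rightarrow> int fps" where
  "weight N k = (if k \<le> N then qfac N ^ 2 * inv_qfac (N - k) * inv_qfac (N + k) else 0)"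

text \<open>
  Equivalently, \<open>weight (N - 1) k = (1 - mac N / mac k) * weight N k\<close>. This rests on
  \<open>(1 - q ^ N)\<^sup>2 - (1 - q ^ (N - k)) * (1 - q ^ (N + k)) = q ^ (N - k) * (1 - q ^ k)\<^sup>2\<close>. For \<open>k = N\<close>
  the factor \<open>1 - q ^ (N - k)\<close> vanishes, in accordance with the default value of \<open>weight\<close>.
\<close>

lemma weight_step:
  assumes "0 < k" "k \<le> N"
  shows "mac k * (weight N k - weight (N - 1) k) = mac N * weight N k"
proof -
  define x y z :: "int fps" where "x = fps_X ^ k" and "y = fps_X ^ (N - k)" and "z = fps_X ^ N"
  note fold_xyz = x_def[symmetric] y_def[symmetric] z_def[symmetric]
  define C where "C = qfac (N - 1) ^ 2 * inv_qfac (N - k) * inv_qfac (N + k)"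
  have N: "N > 0" using assms by simp
  have 1: "weight N k = C * (1 - fps_X ^ N) ^ 2"
    using assms unfolding weight_def C_def qfac_pred[OF N] by (simp add: power_mult_distrib mult_ac)
  have 2: "weight (N - 1) k = C * ((1 - fps_X ^ (N - k)) * (1 - fps_X ^ (N + k)))"
  proof (cases "k = N")
    case True
    then show ?thesis using N by (simp add: weight_def)
  next
    case False
    then have "inv_qfac (N - 1 - k) = inv_qfac (N - k) * (1 - fps_X ^ (N - k))"
      using inv_qfac_pred[of "N - k"] assms by (simp add: diff_commute)
    moreover have "inv_qfac (N - 1 + k) = inv_qfac (N + k) * (1 - fps_X ^ (N + k))"
      using inv_qfac_pred[of "N + k"] assms by simp
    moreover have "weight (N - 1) k = qfac (N - 1) ^ 2 * inv_qfac (N - 1 - k) * inv_qfac (N - 1 + k)"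
      using False assms unfolding weight_def by auto
    ultimately show ?thesis by (simp add: C_def mult_ac)
  qed
  have z: "z = y * x"
    using assms by (simp add: x_def y_def z_def power_add[symmetric])
  have "mac k * (weight N k - weight (N - 1) k) =
      x * (1 + geo k) ^ 2 * (C * ((1 - z) ^ 2 - (1 - y) * (1 - z * x)))"
    unfolding 1 2 mac_def power_add fold_xyz by (simp add: right_diff_distrib)
  also have "(1 - z) ^ 2 - (1 - y) * (1 - z * x) = y * (1 - x) ^ 2"
    unfolding z by algebra
  also have "x * (1 + geo k) ^ 2 * (C * (y * (1 - x) ^ 2)) = C * z * ((1 - x) * (1 + geo k)) ^ 2"
    unfolding z by algebra
  also have "\<dots> = C * z * ((1 - z) * (1 + geo N)) ^ 2"
    unfolding x_def z_def denom_inverse[OF assms(1)] denom_inverse[OF N] ..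
  also have "\<dots> = mac N * weight N k"
    unfolding 1 mac_def fold_xyz by algebra
  finally show ?thesis .
qed

definition numer :: "nat \<Rightarrow> int fps" where
  "numer k = (-1) ^ (k - 1) * (1 + fps_X ^ k) * fps_X ^ (k choose 2)"

lemma M_term_eq:
  assumes "k > 0"
  shows "M_term t k = numer k * mac k ^ t"
proof -
  have den: "M_den t k * (1 + geo k) ^ (2 * t) = 1"
    unfolding M_den_def power_mult_distrib[symmetric] denom_inverse[OF assms] by simp
  moreover have "M_den t k * fps_right_inverse (M_den t k) 1 = 1"
    using assms by (intro M_den_inverse) simp
  ultimately have "M_den t k * fps_right_inverse (M_den t k) 1 = M_den t k * (1 + geo k) ^ (2 * t)"
    by simp
  moreover have "M_den t k \<noteq> 0"
    using den by auto
  ultimately have "fps_right_inverse (M_den t k) 1 = (1 + geo k) ^ (2 * t)"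
    by simp
  moreover have "mac k ^ t = fps_X ^ (t * k) * (1 + geo k) ^ (2 * t)"
    unfolding mac_def power_mult_distrib power_mult[symmetric] by (simp only: mult.commute)
  ultimately show ?thesis
    by (simp add: M_term_def numer_def power_add mult_ac)
qed

text \<open>
  It will turn out that this is \<open>h\<^sub>t (mac 1, \<dots>, mac N)\<close>, the complete homogeneous symmetric
  function of degree \<open>t\<close>.
\<close>

definition fin_M :: "nat \<Rightarrow> nat \<Rightarrow> int fps" where
  "fin_M t N = (\<Sum>k\<in>{1..N}. M_term t k * weight N k)"

text \<open>
  A finite form of the telescoping series \<open>\<Sum> (-1) ^ k * (1 + q ^ k) * q ^ (k choose 2)\<close>, in which
  \<open>(k choose 2) + k = (k + 1) choose 2\<close>. The closed form of the partial sums was chosen so that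
  the step is \<open>(1 - q ^ (N + K)) - (1 + q ^ K) * (1 - q ^ N) = - q ^ K * (1 - q ^ (N - K))\<close>; it vanishes
  at \<open>K = N\<close>, which gives \<open>fin_M 0 N = 1\<close>.
\<close>

lemma weighted_numer_partial_sum:
  assumes "N > 0" "K \<le> N"
  shows "1 - (\<Sum>k\<in>{1..K}. numer k * weight N k) = 
    (-1) ^ K * fps_X ^ (Suc K choose 2) * (1 - fps_X ^ (N - K)) * qfac (N - 1) * qfac N * inv_qfac (N - K) * inv_qfac (N + K)"
  using \<open>K \<le> N\<close>
proof (induction K)
  case 0
  have "1 = (qfac N * inv_qfac N) * (qfac N * inv_qfac N)" by (simp add: qfac_mult_inv_qfac)
  also have "\<dots> = (1 - fps_X ^ N) * qfac (N - 1) * qfac N * inv_qfac N * inv_qfac N"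
    by (subst (1) qfac_pred[OF assms(1)]) (simp only: mult_ac)
  finally show ?case by (simp add: numeral_2_eq_2)
next
  case (Suc K)
  define B where "B = (-1) ^ K * fps_X ^ (Suc K choose 2) * qfac (N - 1) * qfac N * inv_qfac (N - Suc K) * inv_qfac (N + Suc K)"
  have "1 - (\<Sum>k\<in>{1..Suc K}. numer k * weight N k) = 
     1 - (\<Sum>k\<in>{1..K}. numer k * weight N k) - numer (Suc K) * weight N (Suc K)"
    by simp
  also have "1 - (\<Sum>k\<in>{1..K}. numer k * weight N k) = B * (1 - fps_X ^ (N + Suc K))"
  proof -
    have "(1 - fps_X ^ (N - K)) * inv_qfac (N - K) = inv_qfac (N - Suc K)"
      using inv_qfac_pred[of "N - K"] Suc.prems by (simp add: mult_ac)
    moreover have "inv_qfac (N + K) = inv_qfac (N + Suc K) * (1 - fps_X ^ (N + Suc K))"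
      using inv_qfac_pred[of "N + Suc K"] by simp
    ultimately show ?thesis
      using Suc.IH Suc.prems unfolding B_def by (simp add: mult_ac)
  qed
  also have "numer (Suc K) * weight N (Suc K) = B * ((1 + fps_X ^ Suc K) * (1 - fps_X ^ N))"
    using Suc.prems unfolding B_def weight_def numer_def power2_eq_square
    by (subst (2) qfac_pred[OF assms(1)]) (simp add: mult_ac)
  also have "B * (1 - fps_X ^ (N + Suc K)) - B * ((1 + fps_X ^ Suc K) * (1 - fps_X ^ N)) = 
     - B * (fps_X ^ Suc K * (1 - fps_X ^ (N - Suc K)))"
  proof -
    define x y :: "int fps" where "x = fps_X ^ Suc K" and "y = fps_X ^ (N - Suc K)"
    define z :: "int fps" where "z = fps_X ^ N"
    have "z = y * x"
      using Suc.prems unfolding x_def y_def z_def by (subst power_add[symmetric]) simp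
    then show ?thesis
      unfolding power_add x_def[symmetric] y_def[symmetric] z_def[symmetric] by algebra
  qed
  also have "\<dots> = (-1) ^ Suc K * fps_X ^ (Suc (Suc K) choose 2) * (1 - fps_X ^ (N - Suc K)) * qfac (N - 1) * qfac N * inv_qfac (N - Suc K) * inv_qfac (N + Suc K)"
  proof -
    have choose: "Suc (Suc K) choose 2 = (Suc K choose 2) + Suc K"
      by (simp add: numeral_2_eq_2)
    show ?thesis
      unfolding B_def choose power_add power_Suc[of "-1"] by (simp add: mult_ac)
  qed
  finally show ?case .
qed

lemma fin_M_0: 
  assumes "N > 0" 
  shows "fin_M 0 N = 1"
proof -
  have "fin_M 0 N = (\<Sum>k\<in>{1..N}. numer k * weight N k)"
    unfolding fin_M_def by (intro sum.cong refl) (simp add: M_term_eq)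
  then show ?thesis using weighted_numer_partial_sum[OF assms order_refl] by simp
qed

text \<open>
  The recursion \<open>h\<^sub>t (x\<^sub>1, \<dots>, x\<^sub>N\<^sub>+\<^sub>1) = h\<^sub>t (x\<^sub>1, \<dots>, x\<^sub>N) + x\<^sub>N\<^sub>+\<^sub>1 * h\<^sub>t\<^sub>-\<^sub>1 (x\<^sub>1, \<dots>, x\<^sub>N\<^sub>+\<^sub>1)\<close>
  characterises complete homogeneous symmetric functions. Here it holds term by term, because a
  change of \<open>t\<close> by one multiplies the \<open>k\<close>-th term by \<open>mac k\<close>, exactly as in
  \<open>weight_step\<close>.
\<close>

lemma fin_M_Suc: "fin_M (Suc t) (Suc N) = fin_M (Suc t) N + mac (Suc N) * fin_M t (Suc N)"
proof -
  have "fin_M (Suc t) N = (\<Sum>k\<in>{1..Suc N}. M_term (Suc t) k * weight N k)"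
    unfolding fin_M_def by (simp add: weight_def)
  then have "fin_M (Suc t) (Suc N) - fin_M (Suc t) N = 
     (\<Sum>k\<in>{1..Suc N}. M_term (Suc t) k * (weight (Suc N) k - weight N k))"
    unfolding fin_M_def by (simp only: sum_subtractf right_diff_distrib)
  also have "\<dots> = (\<Sum>k\<in>{1..Suc N}. M_term t k * (mac (Suc N) * weight (Suc N) k))"
  proof (intro sum.cong refl)
    fix k assume k: "k \<in> {1..Suc N}"
    then show "M_term (Suc t) k * (weight (Suc N) k - weight N k) = M_term t k * (mac (Suc N) * weight (Suc N) k)"
      using weight_step[of k "Suc N"] by (simp add: M_term_eq mult_ac)
  qed
  also have "\<dots> = mac (Suc N) * fin_M t (Suc N)"
    unfolding fin_M_def by (simp only: sum_distrib_left mult.left_commute)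
  finally show ?thesis by (simp add: algebra_simps)
qed

definition power_sum :: "nat \<Rightarrow> nat \<Rightarrow> int fps" where
  "power_sum i N = (\<Sum>k\<in>{1..N}. mac k ^ i)"

lemma power_sum_Suc: "power_sum i (Suc N) = power_sum i N + mac (Suc N) ^ i"
  by (simp add: power_sum_def)

lemma empty_sums [simp]: "fin_M t 0 = 0" "power_sum i 0 = 0"
  by (simp_all add: fin_M_def power_sum_def)

text \<open>Newton's identities for \<open>h\<^sub>1\<close>, \<open>h\<^sub>2\<close>, \<open>h\<^sub>3\<close>, obtained from the recursion by induction on \<open>N\<close>.\<close>

lemma fin_M_1: "fin_M 1 N = power_sum 1 N"
  by (induction N) (simp_all add: fin_M_Suc fin_M_0 power_sum_Suc)

lemma fin_M_2: "2 * fin_M 2 N = power_sum 1 N ^ 2 + power_sum 2 N"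
proof (induction N)
  case (Suc N)
  have "fin_M 2 (Suc N) = fin_M 2 N + mac (Suc N) * power_sum 1 (Suc N)"
    using fin_M_Suc[of 1 N] fin_M_1[of "Suc N"] by (simp add: numeral_2_eq_2)
  then have step: "2 * fin_M 2 (Suc N) = 2 * fin_M 2 N + 2 * mac (Suc N) * power_sum 1 (Suc N)"
    by simp
  show ?case
    unfolding step Suc.IH power_sum_Suc power_one_right by algebra
qed simp

lemma fin_M_3:
  "6 * fin_M 3 N = power_sum 1 N ^ 3 + 3 * power_sum 1 N * power_sum 2 N + 2 * power_sum 3 N"
proof (induction N)
  case (Suc N)
  have "fin_M 3 (Suc N) = fin_M 3 N + mac (Suc N) * fin_M 2 (Suc N)"
    using fin_M_Suc[of 2 N] by (simp add: numeral_2_eq_2 numeral_3_eq_3)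
  then have step: "6 * fin_M 3 (Suc N) = 6 * fin_M 3 N + 3 * mac (Suc N) * (2 * fin_M 2 (Suc N))"
    by simp
  show ?case
    unfolding step Suc.IH fin_M_2 power_sum_Suc power_one_right by algebra
qed simp

lemma agree_qfac: "K \<le> N \<Longrightarrow> agree K (qfac N) (qfac K)"
proof (induction N)
  case (Suc N)
  show ?case
  proof (cases "K = Suc N")
    case False
    then have "qfac (Suc N) = qfac N - fps_X ^ Suc N * qfac N"
      by (simp add: qfac_Suc algebra_simps)
    moreover have "agree K \<dots> (qfac K - 0)"
      using False Suc by (intro agree_diff agree_X_power_mult) auto
    ultimately show ?thesis by simp
  qed simp
qed simp

text \<open>
  For large \<open>N\<close> the weights tend to \<open>1\<close>. The agreement is only up to degree \<open>N - k\<close>, but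
  the \<open>k\<close>-th term of the sum contains \<open>q ^ (t * k)\<close>, and \<open>t \<ge> 1\<close> makes up for the loss.
\<close>

lemma agree_weight:
  assumes "k \<le> N"
  shows "agree (N - k) (weight N k) 1"
proof -
  have a: "agree (N - k) (qfac N * inv_qfac (N - k)) 1"
    using agree_mult[OF agree_qfac[of "N - k" N] agree_refl[of _ "inv_qfac (N - k)"]] by (simp add: qfac_mult_inv_qfac)
  have b: "agree N (qfac N * inv_qfac (N + k)) 1"
    using agree_mult[OF agree_sym[OF agree_qfac[of N "N + k"]] agree_refl[of _ "inv_qfac (N + k)"]] by (simp add: qfac_mult_inv_qfac)
  have "agree (N - k) ((qfac N * inv_qfac (N - k)) * (qfac N * inv_qfac (N + k))) (1 * 1)"
    by (intro agree_mult a agree_mono[OF b]) simp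
  then show ?thesis
    using assms by (simp add: weight_def power2_eq_square mult_ac)
qed

lemma agree_M_gf:
  assumes "t > 0"
  shows "agree N (M_gf t) (fin_M t N)"
proof -
  have "agree N (M_gf t) (\<Sum>k\<in>{1..N}. M_term t k)"
    unfolding agree_def
  proof (intro allI impI)
    fix n assume n: "n \<le> N"
    have "(\<lambda>m. \<Sum>k<m. M_term t (Suc k)) \<longlonglongrightarrow> M_gf t"
      using M_gf_sums[of t] assms by (simp add: sums_def)
    then have "\<forall>\<^sub>F m in sequentially. fps_nth (\<Sum>k<m. M_term t (Suc k)) n = fps_nth (M_gf t) n"
      by (simp add: tendsto_fps_iff)
    then have "\<forall>\<^sub>F m in sequentially. m \<ge> N \<and> fps_nth (\<Sum>k<m. M_term t (Suc k)) n = fps_nth (M_gf t) n"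
      by (intro eventually_conj eventually_ge_at_top)
    then obtain m where m: "m \<ge> N" "fps_nth (\<Sum>k<m. M_term t (Suc k)) n = fps_nth (M_gf t) n"
      by (auto simp: eventually_sequentially)
    have "fps_nth (\<Sum>k<m. M_term t (Suc k)) n = (\<Sum>k<N. fps_nth (M_term t (Suc k)) n)"
      unfolding fps_sum_nth using m(1) n assms
      by (intro sum.mono_neutral_right) (auto simp: M_term_nth_eq_0)
    also have "\<dots> = (\<Sum>k\<in>{1..N}. fps_nth (M_term t k) n)"
      by (rule sum.reindex_bij_witness[of _ "\<lambda>k. k - 1" Suc]) auto
    finally show "fps_nth (M_gf t) n = fps_nth (\<Sum>k\<in>{1..N}. M_term t k) n"
      using m by (simp add: fps_sum_nth)
  qed
  also have "agree N (\<Sum>k\<in>{1..N}. M_term t k) (fin_M t N)"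
    unfolding fin_M_def
  proof (rule agree_sum)
    fix k assume k: "k \<in> {1..N}"
    obtain s where s: "t = Suc s" using assms by (cases t) auto
    have M: "M_term t k = fps_X ^ k * (numer k * (1 + geo k) ^ 2 * mac k ^ s)"
      using k by (simp add: M_term_eq s mac_def mult_ac)
    have "agree (N - k + k) (fps_X ^ k * (numer k * (1 + geo k) ^ 2 * mac k ^ s * weight N k))
       (fps_X ^ k * (numer k * (1 + geo k) ^ 2 * mac k ^ s * 1))"
      using k by (intro agree_mult_X_power agree_mult agree_refl agree_weight) simp
    then show "agree N (M_term t k) (M_term t k * weight N k)"
      using k agree_sym unfolding M by (simp add: mult.assoc)
  qed
  finally show ?thesis .
qed

section \<open>Power sums of MacMahon's series\<close>

text \<open>
  The substitution \<open>q \<mapsto> q ^ k\<close> in the generating function of \<open>f\<close>.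
\<close>

definition dilate :: "(nat \<Rightarrow> int) \<Rightarrow> nat \<Rightarrow> int fps" where
  "dilate f k = Abs_fps (\<lambda>n. if k dvd n then f (n div k) else 0)"

lemma numeral_mult_nth: "fps_nth (numeral c * f) n = numeral c * fps_nth f n"
  unfolding fps_numeral_fps_const by (rule fps_mult_left_const_nth)

lemma numeral_mult_dilate: "numeral c * dilate f k = dilate (\<lambda>m. numeral c * f m) k"
  by (intro fps_ext) (simp add: dilate_def numeral_mult_nth)

lemma dilate_nth_mult: "k > 0 \<Longrightarrow> fps_nth (dilate f k) (k * m) = f m"
  by (simp add: dilate_def)

text \<open>
  Both sides have the coefficients \<open>\<Sum> f d\<close>, summed over the divisors \<open>d\<close> of the
  degree; the exchange is \<open>d \<mapsto> n div d\<close>.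
\<close>

lemma agree_sum_dilate:
  assumes f0: "f 0 = 0"
  shows "agree N (\<Sum>k\<in>{1..N}. dilate f k) (\<Sum>m\<in>{1..N}. of_int (f m) * geo m)"
  unfolding agree_def
proof (intro allI impI)
  fix n assume n: "n \<le> N"
  show "fps_nth (\<Sum>k\<in>{1..N}. dilate f k) n = fps_nth (\<Sum>m\<in>{1..N}. of_int (f m) * geo m) n"
  proof (cases "n = 0")
    case False
    have "(\<Sum>k\<in>{1..N}. if k dvd n then f (n div k) else 0) = (\<Sum>k\<in>{k\<in>{1..N}. k dvd n}. f (n div k))"
      by (rule sum.inter_filter[symmetric]) simp
    also have "\<dots> = (\<Sum>m\<in>{m\<in>{1..N}. m dvd n}. f m)"
      by (rule sum.reindex_bij_witness[of _ "\<lambda>m. n div m" "\<lambda>m. n div m"])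
         (use False n in \<open>auto simp: Suc_le_eq div_greater_zero_iff dvd_imp_le intro: order.trans[OF div_le_dividend]\<close>)
    also have "\<dots> = (\<Sum>m\<in>{1..N}. if m dvd n then f m else 0)"
      by (rule sum.inter_filter) simp
    also have "\<dots> = (\<Sum>m\<in>{1..N}. f m * of_bool (0 < n \<and> m dvd n))"
      using False by (intro sum.cong) auto
    finally show ?thesis
      by (simp add: dilate_def fps_sum_nth flip: fps_of_int)
  qed (simp add: dilate_def fps_sum_nth f0 flip: fps_of_int)
qed

text \<open>
  Multiplication by \<open>(1 - q ^ k)\<^sup>2\<close> takes second differences of the coefficients, so
  multiplication by \<open>mac k\<close> undoes a second difference. Applied repeatedly this finds the
  coefficients of the powers of \<open>mac k\<close>, which are \<open>(m + i - 1) choose (2 * i - 1)\<close>: second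
  differences of \<open>m ^ 3 - m\<close> are \<open>6 * m\<close>, and those of \<open>m ^ 5 - 5 * m ^ 3 + 4 * m\<close> are \<open>20 * (m ^ 3 - m)\<close>.
  The condition on \<open>f 1\<close> is the second difference at \<open>0\<close> for the extension of \<open>f\<close> by \<open>0\<close>.
\<close>

lemma mac_mult_dilate:
  assumes k: "k > 0" and f0: "f 0 = 0" and f1: "f 1 = g 0"
    and diff: "\<And>m. f (m + 2) - 2 * f (m + 1) + f m = g (m + 1)"
  shows "mac k * dilate g k = dilate f k"
proof -
  define x :: "int fps" where "x = fps_X ^ k"
  have "dilate f k - x * dilate f k - x * dilate f k + x * (x * dilate f k) = x * dilate g k"
  proof (rule fps_ext)
    fix n
    have nth_x: "fps_nth (x * h) n = (if n < k then 0 else fps_nth h (n - k))" for h n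
      unfolding x_def by (rule fps_X_power_mult_nth)
    show "fps_nth (dilate f k - x * dilate f k - x * dilate f k + x * (x * dilate f k)) n =
        fps_nth (x * dilate g k) n"
    proof (cases "k dvd n")
      case True
      then obtain j where j: "n = k * j" by auto
      have "j = 0 \<or> j = 1 \<or> (\<exists>i. j = i + 2)"
        by presburger
      then consider "j = 0" | "j = 1" | i where "j = i + 2"
        by blast
      then show ?thesis
      proof cases
        case 3
        have n: "n = k * (i + 2)" "n - k = k * (i + 1)" "n - k - k = k * i" "\<not> n < k" "\<not> n - k < k"
          unfolding j 3 by (simp_all add: algebra_simps)
        have nth2: "fps_nth (dilate h k) n = h (i + 2)" for h
          unfolding n(1) by (rule dilate_nth_mult[OF k])
        have nth1: "fps_nth (dilate h k) (n - k) = h (i + 1)" for h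
          unfolding n(2) by (rule dilate_nth_mult[OF k])
        have nth0: "fps_nth (dilate h k) (n - k - k) = h i" for h
          unfolding n(3) by (rule dilate_nth_mult[OF k])
        show ?thesis
          using diff[of i] n(4,5) by (simp only: fps_sub_nth fps_add_nth nth_x nth2 nth1 nth0 if_False)
      qed (use k f0 f1 in \<open>simp_all only: nth_x fps_add_nth fps_sub_nth, simp_all add: j dilate_def\<close>)
    next
      case False
      then show ?thesis
        by (simp only: nth_x fps_add_nth fps_sub_nth) (simp add: dilate_def dvd_minus_self del: diff_diff_left)
    qed
  qed
  then have "dilate f k * ((1 - x) * (1 + geo k)) ^ 2 = x * (1 + geo k) ^ 2 * dilate g k"
    by algebra
  then show ?thesis
    unfolding x_def mac_def denom_inverse[OF k] by simp
qed

lemma mac_power_1: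
  assumes "k > 0"
  shows "mac k = dilate int k"
proof -
  have "dilate (\<lambda>m. of_bool (m = 0)) k = 1"
    using assms by (intro fps_ext) (auto simp: dilate_def)
  moreover have "mac k * dilate (\<lambda>m. of_bool (m = 0)) k = dilate int k"
    using assms by (intro mac_mult_dilate) simp_all
  ultimately show ?thesis by simp
qed

lemma mac_power_2:
  assumes "k > 0"
  shows "6 * mac k ^ 2 = dilate (\<lambda>m. int m ^ 3 - int m) k"
proof -
  have "6 * mac k ^ 2 = mac k * (6 * mac k)"
    by (simp add: power2_eq_square)
  also have "6 * mac k = dilate (\<lambda>m. 6 * int m) k"
    unfolding mac_power_1[OF assms] numeral_mult_dilate ..
  also have "mac k * \<dots> = dilate (\<lambda>m. int m ^ 3 - int m) k"
    using assms by (intro mac_mult_dilate) (simp_all add: algebra_simps power3_eq_cube)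
  finally show ?thesis .
qed

lemma mac_power_3:
  assumes "k > 0"
  shows "120 * mac k ^ 3 = dilate (\<lambda>m. int m ^ 5 - 5 * int m ^ 3 + 4 * int m) k"
proof -
  have "120 * mac k ^ 3 = mac k * (20 * (6 * mac k ^ 2))"
    by (simp add: power2_eq_square power3_eq_cube)
  also have "20 * (6 * mac k ^ 2) = dilate (\<lambda>m. 20 * (int m ^ 3 - int m)) k"
    unfolding mac_power_2[OF assms] numeral_mult_dilate ..
  also have "mac k * \<dots> = dilate (\<lambda>m. int m ^ 5 - 5 * int m ^ 3 + 4 * int m) k"
    using assms by (intro mac_mult_dilate) (simp_all add: algebra_simps power_numeral_reduce)
  finally show ?thesis .
qed

lemma agree_power_sum_1: "agree N (power_sum 1 N) (lambert 1 N)"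
  using agree_sum_dilate[of int N] by (simp add: power_sum_def lambert_def mac_power_1)

lemma agree_power_sum_2: "agree N (6 * power_sum 2 N) (lambert 3 N - lambert 1 N)"
  using agree_sum_dilate[of "\<lambda>m. int m ^ 3 - int m" N]
  by (simp add: power_sum_def lambert_def mac_power_2 sum_distrib_left left_diff_distrib sum_subtractf)

lemma agree_power_sum_3:
  "agree N (120 * power_sum 3 N) (lambert 5 N - 5 * lambert 3 N + 4 * lambert 1 N)"
proof -
  let ?f = "\<lambda>m. int m ^ 5 - 5 * int m ^ 3 + 4 * int m"
  have "120 * power_sum 3 N = (\<Sum>k\<in>{1..N}. dilate ?f k)"
    by (simp add: power_sum_def mac_power_3 sum_distrib_left)
  moreover have "(\<Sum>m\<in>{1..N}. of_int (?f m) * geo m) = lambert 5 N - 5 * lambert 3 N + 4 * lambert 1 N"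
    by (simp add: lambert_def sum_distrib_left distrib_right left_diff_distrib sum_subtractf sum.distrib mult.assoc)
  ultimately show ?thesis
    using agree_sum_dilate[of ?f N] by simp
qed

section \<open>Formulas in terms of divisor power sums\<close>

abbreviation sigma :: "nat \<Rightarrow> nat \<Rightarrow> int" where
  "sigma j n \<equiv> (\<Sum>d | d dvd n. int d ^ j)"

lemma M_1: "n > 0 \<Longrightarrow> M 1 n = sigma 1 n"
proof -
  assume n: "n > 0"
  have "agree n (M_gf 1) (lambert 1 n)"
    using agree_trans[OF agree_M_gf[of 1 n] agree_power_sum_1[of n, folded fin_M_1]] by simp
  then show ?thesis using n lambert_nth[of n n 1] by (simp add: agree_def M_def)
qed

lemma M_2:
  assumes n: "n > 0"
  shows "24 * M 2 n = 7 * sigma 3 n - (6 * int n + 1) * sigma 1 n"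
proof -
  have "agree n (24 * fin_M 2 n) (12 * lambert 1 n ^ 2 + 2 * (lambert 3 n - lambert 1 n))"
  proof -
    have "24 * fin_M 2 n = 12 * power_sum 1 n ^ 2 + 2 * (6 * power_sum 2 n)"
      using fin_M_2[of n] by algebra
    then show ?thesis
      unfolding power2_eq_square
      by (simp only:) (intro agree_add agree_mult agree_refl agree_power_sum_1 agree_power_sum_2)
  qed
  also have "agree n \<dots> (5 * lambert 3 n + lambert 1 n - 6 * qderiv (lambert 1 n) + 2 * (lambert 3 n - lambert 1 n))"
    by (intro agree_add agree_refl lambert_1_square)
  finally have "agree n (24 * fin_M 2 n) \<dots>" .
  then have "24 * fps_nth (fin_M 2 n) n =
      5 * sigma 3 n + sigma 1 n - 6 * (int n * sigma 1 n) + 2 * (sigma 3 n - sigma 1 n)"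
    using lambert_nth[OF n order_refl] by (simp only: agree_def order_refl numeral_mult_nth qderiv_nth fps_add_nth fps_sub_nth)
  moreover have "M 2 n = fps_nth (fin_M 2 n) n"
    using agree_M_gf[of 2 n] by (simp add: agree_def M_def)
  ultimately show ?thesis by algebra
qed

text \<open>
  The cubic term of \<open>h\<^sub>3\<close> needs no third convolution: multiplying the formula for
  \<open>(lambert 1)\<^sup>2\<close> by \<open>lambert 1\<close> leaves a product with \<open>lambert 3\<close>, which is known, and a product
  with \<open>qderiv (lambert 1)\<close>, which is half the derivative of the square. The multiplier
  \<open>17280 = 2 ^ 7 * 3 ^ 3 * 5\<close> clears all denominators and is prime to \<open>7\<close>.
\<close>

lemma M_3:
  assumes n: "n > 0"
  shows "17280 * M 3 n = 279 * sigma 5 n - 630 * (int n + 1) * sigma 3 n + (360 * int n ^ 2 + 540 * int n + 81) * sigma 1 n"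
proof -
  define S where "S = (\<lambda>j. lambert j n)"
  define u v w where "u = S 1 ^ 2" and "v = S 1 * S 3" and "w = S 1 * u"
  have u: "agree n (12 * u) (5 * S 3 + S 1 - 6 * qderiv (S 1))"
    unfolding u_def S_def by (rule lambert_1_square)
  have v: "agree n (240 * v) (21 * S 5 + 10 * S 3 - S 1 - 30 * qderiv (S 3))"
    unfolding v_def S_def by (rule lambert_1_mult_3)
  have w: "agree n (12 * w) (5 * v + u - 3 * qderiv u)"
  proof -
    have scaled: "agree n (S 1 * (12 * u)) (S 1 * (5 * S 3 + S 1 - 6 * qderiv (S 1)))"
      by (rule agree_mult[OF agree_refl u])
    have "qderiv u = 2 * S 1 * qderiv (S 1)"
      unfolding u_def power2_eq_square qderiv_mult by (simp add: algebra_simps)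
    then have rhs: "S 1 * (5 * S 3 + S 1 - 6 * qderiv (S 1)) = 5 * v + u - 3 * qderiv u"
      unfolding v_def by (simp add: u_def algebra_simps power2_eq_square)
    have lhs: "S 1 * (12 * u) = 12 * w"
      by (simp add: w_def)
    show ?thesis using scaled unfolding lhs rhs .
  qed
  have "agree n (120 * (6 * fin_M 3 n)) (120 * w + 60 * (v - u) + 2 * (S 5 - 5 * S 3 + 4 * S 1))"
  proof -
    have "120 * (6 * fin_M 3 n) = 120 * (power_sum 1 n * power_sum 1 n ^ 2) + 60 * (power_sum 1 n * (6 * power_sum 2 n)) + 2 * (120 * power_sum 3 n)"
      using fin_M_3[of n] by algebra
    moreover have "agree n \<dots> (120 * (S 1 * (S 1 * S 1)) + 60 * (S 1 * (S 3 - S 1)) + 2 * (S 5 - 5 * S 3 + 4 * S 1))"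
      unfolding S_def power2_eq_square
      by (intro agree_add agree_mult agree_refl agree_power_sum_1 agree_power_sum_2 agree_power_sum_3)
    ultimately show ?thesis
      by (simp add: w_def u_def v_def power2_eq_square algebra_simps)
  qed
  moreover have "fps_nth (S j) n = sigma j n" for j
    unfolding S_def using n by (rule lambert_nth) simp
  moreover have "M 3 n = fps_nth (fin_M 3 n) n"
    using agree_M_gf[of 3 n] by (simp add: agree_def M_def)
  moreover note u v w
  ultimately have
      eqs: "720 * M 3 n = 120 * fps_nth w n + 60 * (fps_nth v n - fps_nth u n) + 2 * (sigma 5 n - 5 * sigma 3 n + 4 * sigma 1 n)"
      "12 * fps_nth w n = 5 * fps_nth v n + fps_nth u n - 3 * (int n * fps_nth u n)"
      "240 * fps_nth v n = 21 * sigma 5 n + 10 * sigma 3 n - sigma 1 n - 30 * (int n * sigma 3 n)"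
      "12 * fps_nth u n = 5 * sigma 3 n + sigma 1 n - 6 * (int n * sigma 1 n)"
    by (simp_all add: agree_def numeral_mult_nth qderiv_nth)
  then show ?thesis by algebra
qed

text \<open>
  A divisor of \<open>4 * m\<close> is \<open>1\<close>, \<open>2\<close> or \<open>4\<close> times a divisor of the odd number \<open>m\<close>, in one way.
\<close>

lemma sigma_4_mult_odd:
  assumes "odd m"
  shows "sigma j (4 * m) = (1 + 2 ^ j + 4 ^ j) * sigma j m"
proof -
  let ?A = "{d. d dvd m}"
  have fin: "finite ?A" using assms by (cases "m = 0") auto
  have odd: "odd d" if "d dvd m" for d using assms that by (metis dvd_trans)
  have "{d. d dvd 4 * m} = ?A \<union> (*) 2 ` ?A \<union> (*) 4 ` ?A"
  proof (intro equalityI subsetI)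
    fix d assume "d \<in> {d. d dvd 4 * m}"
    then have "d dvd 4 * m" by simp
    then obtain a b where ab: "d = a * b" "a dvd 4" "b dvd m" by (rule dvd_productE)
    have "a \<le> 4" using ab(2) by (rule dvd_imp_le) simp
    with ab(2) have "a \<in> {1, 2, 4}" by (cases "a = 0"; cases "a = 3") auto
    with ab show "d \<in> ?A \<union> (*) 2 ` ?A \<union> (*) 4 ` ?A" by auto
  next
    fix d assume "d \<in> ?A \<union> (*) 2 ` ?A \<union> (*) 4 ` ?A"
    then show "d \<in> {d. d dvd 4 * m}"
      by (auto intro: mult_dvd_mono)
  qed
  moreover have "?A \<inter> (*) 2 ` ?A = {}" "(?A \<union> (*) 2 ` ?A) \<inter> (*) 4 ` ?A = {}"
    using odd by (auto dest!: odd)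
  ultimately have "sigma j (4 * m) = sum (\<lambda>d. int d ^ j) ?A + sum (\<lambda>d. int d ^ j) ((*) 2 ` ?A) + sum (\<lambda>d. int d ^ j) ((*) 4 ` ?A)"
    using fin by (simp add: sum.union_disjoint)
  also have "\<dots> = (1 + 2 ^ j + 4 ^ j) * sigma j m"
    by (simp add: sum.reindex inj_on_def power_mult_distrib distrib_right sum_distrib_left sum.distrib)
  finally show ?thesis .
qed

theorem theorem8p2:
  fixes t n :: nat
  assumes "t \<in> {1, 2, 3}"
  shows "7 dvd M t (8 * n + 4)"
proof -
  let ?N = "8 * n + 4"
  have N: "?N = 4 * (2 * n + 1)" and pos: "?N > 0" by simp_all
  have "sigma 1 ?N = 7 * sigma 1 (2 * n + 1)" "sigma 5 ?N = 7 * (151 * sigma 5 (2 * n + 1))"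
    unfolding N by (subst sigma_4_mult_odd; simp)+
  then have s1: "7 dvd sigma 1 ?N" and s5: "7 dvd sigma 5 ?N"
    by (metis dvd_triv_left)+
  consider "t = 1" | "t = 2" | "t = 3" using assms by auto
  then show ?thesis
  proof cases
    case 1
    then show ?thesis using s1 M_1[OF pos] by simp
  next
    case 2
    have "7 dvd 24 * M 2 ?N"
      unfolding M_2[OF pos] by (rule dvd_diff[OF dvd_triv_left dvd_mult[OF s1]])
    \<comment> \<open>As \<open>5 * 24 - 7 * 17 = 1\<close>, the multiplier can be removed; the third case is similar.\<close>
    then have "7 dvd 5 * (24 * M 2 ?N) - 7 * (17 * M 2 ?N)"
      by (rule dvd_diff[OF dvd_mult dvd_triv_left])
    then show ?thesis using 2 by simp
  next
    case 3
    have "7 dvd 17280 * M 3 ?N"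
      unfolding M_3[OF pos] by (intro dvd_add[OF dvd_diff[OF dvd_mult[OF s5] dvd_mult2[OF dvd_mult2]] dvd_mult[OF s1]]) simp
    then have "7 dvd 2 * (17280 * M 3 ?N) - 7 * (4937 * M 3 ?N)"
      by (rule dvd_diff[OF dvd_mult dvd_triv_left])
    then show ?thesis using 3 by simp
  qed
qed

end
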